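(* Let $P \in NCB_{\mathcal{D}}(B(\mathcal{H}))$ be an idempotent with symbol $\Gamma(P) = \chi$. Then there exists an $\omega$-open and $\omega$-closed set $A \subseteq X\times X$ such that $\chi = \chi_A$ marginally almost everywhere, where $\chi_A$ is the indicator function of $A$.
   Context: $(X,\mu)$ is a standard finite Borel measure space, $\mathcal{H}=L^2(X,\mu)$ (separable) and $\mathcal{D}=L^\infty(X,\mu)$ acts on $\mathcal{H}$ by multiplication operators $M_f$. A linear map $\Phi$ on $B(\mathcal{H})$ is a $\mathcal{D}$-bimodule map if $\Phi(D_1TD_2)=D_1\Phi(T)D_2$ for all $T\in B(\mathcal{H})$, $D_1,D_2\in\mathcal{D}$. $NCB_{\mathcal{D}}(B(\mathcal{H}))$ is the algebra (under composition) of all w*-continuous $\mathcal{D}$-bimodule maps from $B(\mathcal{H})$ into itself; idempotent means $P\circ P=P$. A set $R\subseteq X\times X$ is marginally null if $R\subseteq (N\times X)\cup(X\times N)$ for some $\mu$-null set $N$; two functions on $X\times X$ are equal marginally almost everywhere (m.a.e.) if the set where they differ is marginally null. A set $E\subseteq X\times X$ is $\omega$-open if it differs from a countable union of Borel rectangles $\alpha\times\beta$ by a marginally null set, and $\omega$-closed if its complement is $\omega$-open. Symbol: every $\Phi\in NCB_{\mathcal{D}}(B(\mathcal{H}))$ can be written (Haagerup) as $\Phi(T)=\sum_{n=1}^\infty M_{f_n}TM_{g_n}$ (w*-convergent) with Borel functions $f_n,g_n:X\to\mathbb{C}$ such that $\sum_n|f_n(s)|^2$ and $\sum_n|g_n(s)|^2$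 converge for all $s\in X$ and are bounded in $s$. The symbol $\Gamma(\Phi)$ is the m.a.e. equivalence class of the Borel function $\phi(s,t)=\sum_n f_n(s)g_n(t)$; it does not depend on the chosen representation. *)

theory Defs
  imports "HOL-Analysis.Analysis"
begin

definition standard_finite_measure :: "'a measure \<Rightarrow> bool" where
  "standard_finite_measure M \<longleftrightarrow> finite_measure M \<and>
     (\<exists>T. completely_metrizable_space T \<and> second_countable T \<and> topspace T = space M \<and>
          sets M = sigma_sets (space M) {U. openin T U})"

section \<open>The Hilbert space of square integrable functions\<close>

text \<open>Vectors are genuine equivalence classes of functions modulo equality almost everywhere.
  Values outside \<^term>\<open>space M\<close> are irrelevant.  The vector operations below go through
  an arbitrary representative.\<close>

definition sq_integrable :: "'a measure \<Rightarrow> ('a \<Rightarrow> complex) set" where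
  "sq_integrable M = {f \<in> borel_measurable M. integrable M (\<lambda>x. (cmod (f x))\<^sup>2)}"

definition ae_rel :: "'a measure \<Rightarrow> (('a \<Rightarrow> complex) \<times> ('a \<Rightarrow> complex)) set" where
  "ae_rel M = {(f, g). f \<in> sq_integrable M \<and> g \<in> sq_integrable M \<and> (AE x in M. f x = g x)}"

definition L2 :: "'a measure \<Rightarrow> ('a \<Rightarrow> complex) set set" where
  "L2 M = sq_integrable M // ae_rel M"

definition l2_class :: "'a measure \<Rightarrow> ('a \<Rightarrow> complex) \<Rightarrow> ('a \<Rightarrow> complex) set" where
  "l2_class M f = ae_rel M `` {f}"

definition l2_rep :: "('a \<Rightarrow> complex) set \<Rightarrow> 'a \<Rightarrow> complex" where
  "l2_rep \<xi> = (SOME f. f \<in> \<xi>)"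

definition l2_zero :: "'a measure \<Rightarrow> ('a \<Rightarrow> complex) set" where
  "l2_zero M = l2_class M (\<lambda>x. 0)"

definition l2_add ::
  "'a measure \<Rightarrow> ('a \<Rightarrow> complex) set \<Rightarrow> ('a \<Rightarrow> complex) set \<Rightarrow> ('a \<Rightarrow> complex) set" where
  "l2_add M \<xi> \<eta> = l2_class M (\<lambda>x. l2_rep \<xi> x + l2_rep \<eta> x)"

definition l2_scale ::
  "'a measure \<Rightarrow> complex \<Rightarrow> ('a \<Rightarrow> complex) set \<Rightarrow> ('a \<Rightarrow> complex) set" where
  "l2_scale M c \<xi> = l2_class M (\<lambda>x. c * l2_rep \<xi> x)"

definition l2_inner ::
  "'a measure \<Rightarrow> ('a \<Rightarrow> complex) set \<Rightarrow> ('a \<Rightarrow> complex) set \<Rightarrow> complex" where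
  "l2_inner M \<xi> \<eta> = (LINT x|M. l2_rep \<xi> x * cnj (l2_rep \<eta> x))"

definition l2_norm :: "'a measure \<Rightarrow> ('a \<Rightarrow> complex) set \<Rightarrow> real" where
  "l2_norm M \<xi> = sqrt (LINT x|M. (cmod (l2_rep \<xi> x))\<^sup>2)"

section \<open>Bounded operators\<close>

type_synonym 'a l2_op = "('a \<Rightarrow> complex) set \<Rightarrow> ('a \<Rightarrow> complex) set"

text \<open>Operators and maps on operators are extensional functions on their carriers, so
  that equality of functions is equality of operators.\<close>

definition bounded_ops :: "'a measure \<Rightarrow> 'a l2_op set" where
  "bounded_ops M = {T \<in> L2 M \<rightarrow>\<^sub>E L2 M.
     (\<forall>\<xi>\<in>L2 M. \<forall>\<eta>\<in>L2 M. T (l2_add M \<xi> \<eta>) = l2_add M (T \<xi>) (T \<eta>)) \<and>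
     (\<forall>c. \<forall>\<xi>\<in>L2 M. T (l2_scale M c \<xi>) = l2_scale M c (T \<xi>)) \<and>
     (\<exists>K. \<forall>\<xi>\<in>L2 M. l2_norm M (T \<xi>) \<le> K * l2_norm M \<xi>)}"

definition op_zero :: "'a measure \<Rightarrow> 'a l2_op" where
  "op_zero M = (\<lambda>\<xi>\<in>L2 M. l2_zero M)"

definition op_add :: "'a measure \<Rightarrow> 'a l2_op \<Rightarrow> 'a l2_op \<Rightarrow> 'a l2_op" where
  "op_add M S T = (\<lambda>\<xi>\<in>L2 M. l2_add M (S \<xi>) (T \<xi>))"

definition op_scale :: "'a measure \<Rightarrow> complex \<Rightarrow> 'a l2_op \<Rightarrow> 'a l2_op" where
  "op_scale M c T = (\<lambda>\<xi>\<in>L2 M. l2_scale M c (T \<xi>))"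

definition op_mult :: "'a measure \<Rightarrow> 'a l2_op \<Rightarrow> 'a l2_op \<Rightarrow> 'a l2_op" where
  "op_mult M S T = compose (L2 M) S T"

primrec op_sum :: "'a measure \<Rightarrow> (nat \<Rightarrow> 'a l2_op) \<Rightarrow> nat \<Rightarrow> 'a l2_op" where
  "op_sum M S 0 = op_zero M"
| "op_sum M S (Suc n) = op_add M (op_sum M S n) (S n)"

definition ess_bounded :: "'a measure \<Rightarrow> ('a \<Rightarrow> complex) set" where
  "ess_bounded M = {f \<in> borel_measurable M. \<exists>C. AE x in M. cmod (f x) \<le> C}"

definition mult_op :: "'a measure \<Rightarrow> ('a \<Rightarrow> complex) \<Rightarrow> 'a l2_op" where
  "mult_op M f = (\<lambda>\<xi>\<in>L2 M. l2_class M (\<lambda>x. f x * l2_rep \<xi> x))"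

definition mult_algebra :: "'a measure \<Rightarrow> 'a l2_op set" where
  "mult_algebra M = mult_op M ` ess_bounded M"

section \<open>The weak-star topology\<close>

definition sq_summable_vectors :: "'a measure \<Rightarrow> (nat \<Rightarrow> ('a \<Rightarrow> complex) set) set" where
  "sq_summable_vectors M =
     {\<xi>. (\<forall>n. \<xi> n \<in> L2 M) \<and> summable (\<lambda>n. (l2_norm M (\<xi> n))\<^sup>2)}"

text \<open>The functionals \<open>T \<mapsto> \<Sum>n. \<langle>T \<xi>\<^sub>n, \<eta>\<^sub>n\<rangle>\<close>, with both sequences square summable in norm,
  are exactly the elements of the predual of \<open>B(H)\<close> (the trace class operators).\<close>

definition predual_functional ::
  "'a measure \<Rightarrow> (nat \<Rightarrow> ('a \<Rightarrow> complex) set) \<Rightarrow> (nat \<Rightarrow> ('a \<Rightarrow> complex) set) \<Rightarrow> 'a l2_op \<Rightarrow> complex"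
  where
  "predual_functional M \<xi> \<eta> T = (\<Sum>n. l2_inner M (T (\<xi> n)) (\<eta> n))"

definition weak_star :: "'a measure \<Rightarrow> 'a l2_op topology" where
  "weak_star M = topology_generated_by
     {{T \<in> bounded_ops M. predual_functional M \<xi> \<eta> T \<in> U} | \<xi> \<eta> U.
        \<xi> \<in> sq_summable_vectors M \<and> \<eta> \<in> sq_summable_vectors M \<and> open U}"

section \<open>Weak-star continuous bimodule maps\<close>

definition NCB :: "'a measure \<Rightarrow> ('a l2_op \<Rightarrow> 'a l2_op) set" where
  "NCB M = {\<Phi> \<in> bounded_ops M \<rightarrow>\<^sub>E bounded_ops M.
     (\<forall>S\<in>bounded_ops M. \<forall>T\<in>bounded_ops M. \<Phi> (op_add M S T) = op_add M (\<Phi> S) (\<Phi> T)) \<and>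
     (\<forall>c. \<forall>T\<in>bounded_ops M. \<Phi> (op_scale M c T) = op_scale M c (\<Phi> T)) \<and>
     (\<forall>T\<in>bounded_ops M. \<forall>D\<in>mult_algebra M. \<forall>E\<in>mult_algebra M.
        \<Phi> (op_mult M D (op_mult M T E)) = op_mult M D (op_mult M (\<Phi> T) E)) \<and>
     continuous_map (weak_star M) (weak_star M) \<Phi>}"

definition idempotent_map :: "'a measure \<Rightarrow> ('a l2_op \<Rightarrow> 'a l2_op) \<Rightarrow> bool" where
  "idempotent_map M P \<longleftrightarrow> compose (bounded_ops M) P P = P"

section \<open>Marginal equivalence and the pseudo-topology of \<open>\<omega>\<close>-open sets\<close>

definition marginally_null :: "'a measure \<Rightarrow> ('a \<times> 'a) set \<Rightarrow> bool" where
  "marginally_null M R \<longleftrightarrow>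
     (\<exists>N\<in>null_sets M. R \<subseteq> (N \<times> space M) \<union> (space M \<times> N))"

definition mae_eq :: "'a measure \<Rightarrow> ('a \<times> 'a \<Rightarrow> complex) \<Rightarrow> ('a \<times> 'a \<Rightarrow> complex) \<Rightarrow> bool" where
  "mae_eq M \<phi> \<psi> \<longleftrightarrow> marginally_null M {z \<in> space M \<times> space M. \<phi> z \<noteq> \<psi> z}"

definition omega_open :: "'a measure \<Rightarrow> ('a \<times> 'a) set \<Rightarrow> bool" where
  "omega_open M E \<longleftrightarrow> E \<subseteq> space M \<times> space M \<and>
     (\<exists>\<alpha> \<beta> :: nat \<Rightarrow> 'a set. (\<forall>n. \<alpha> n \<in> sets M \<and> \<beta> n \<in> sets M) \<and>
        marginally_null M (sym_diff E (\<Union>n. \<alpha> n \<times> \<beta> n)))"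

definition omega_closed :: "'a measure \<Rightarrow> ('a \<times> 'a) set \<Rightarrow> bool" where
  "omega_closed M E \<longleftrightarrow> E \<subseteq> space M \<times> space M \<and> omega_open M (space M \<times> space M - E)"

section \<open>Symbols\<close>

definition bounded_square_sums :: "'a measure \<Rightarrow> (nat \<Rightarrow> 'a \<Rightarrow> complex) \<Rightarrow> bool" where
  "bounded_square_sums M f \<longleftrightarrow> (\<forall>n. f n \<in> borel_measurable M) \<and>
     (\<forall>s\<in>space M. summable (\<lambda>n. (cmod (f n s))\<^sup>2)) \<and>
     (\<exists>C. \<forall>s\<in>space M. (\<Sum>n. (cmod (f n s))\<^sup>2) \<le> C)"

definition represents ::
  "'a measure \<Rightarrow> ('a l2_op \<Rightarrow> 'a l2_op) \<Rightarrow> (nat \<Rightarrow> 'a \<Rightarrow> complex) \<Rightarrow> (nat \<Rightarrow> 'a \<Rightarrow> complex) \<Rightarrow> bool"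
  where
  "represents M \<Phi> f g \<longleftrightarrow> bounded_square_sums M f \<and> bounded_square_sums M g \<and>
     (\<forall>T\<in>bounded_ops M.
        limitin (weak_star M)
          (op_sum M (\<lambda>n. op_mult M (mult_op M (f n)) (op_mult M T (mult_op M (g n)))))
          (\<Phi> T) sequentially)"

text \<open>The symbol is an equivalence class of functions, modelled as the set of its members.
  Different representations of the same map give the same class.\<close>

definition symbol :: "'a measure \<Rightarrow> ('a l2_op \<Rightarrow> 'a l2_op) \<Rightarrow> ('a \<times> 'a \<Rightarrow> complex) set" where
  "symbol M \<Phi> = {\<phi>. \<exists>f g. represents M \<Phi> f g \<and> mae_eq M \<phi> (\<lambda>(s, t). \<Sum>n. f n s * g n t)}"

end

theory Submission
  imports Defs
begin

text \<open>
  Let \<open>\<psi>(s,t) = \<Sum>n. f\<^sub>n(s) g\<^sub>n(t)\<close> be the function given by one representation of \<open>P\<close>.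
  Two facts give the result: \<open>\<psi>\<close> pulls open sets back to countable unions of measurable rectangles,
  and \<open>\<psi>\<^sup>2 = \<psi>\<close> outside a marginally null set.  With both, \<open>A = {\<psi> \<noteq> 0}\<close> works: it is a countable
  union of rectangles, and its complement differs only by a marginally null set from \<open>{\<psi> \<noteq> 1}\<close>,
  which is also one.

  The first fact (\<open>rect_continuous_symbol_sum\<close>) holds because \<open>\<psi>\<close> factors through the separable
  space of square summable sequences, where the pairing is continuous.  Concretely, a partial sum is
  a continuous function of finitely many functions of a single coordinate, and it differs from
  \<open>\<psi>(s,t)\<close> by at most a function of \<open>s\<close> plus a function of \<open>t\<close> (halves of the square tails) that tend
  to zero pointwise (\<open>rect_continuous_limit\<close>).

  For the second fact it suffices to watch one rank-one operator \<open>T\<^sub>0 \<xi> = (\<integral>\<xi>) 1\<close>.  Its integral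
  kernel is the constant 1, and applying a represented map multiplies a kernel by the symbol
  (\<open>has_kernel_represented\<close>).  So \<open>P T\<^sub>0\<close> has kernel \<open>\<psi>\<close>, \<open>P (P T\<^sub>0)\<close> has kernel \<open>\<psi>\<^sup>2\<close>, and
  idempotence shows that \<open>\<psi>\<^sup>2 - \<psi>\<close> integrates to zero over every rectangle.  This would only give
  equality almost everywhere for the product measure, but \<open>{\<psi>\<^sup>2 \<noteq> \<psi>}\<close> is a countable union of
  rectangles on each of which \<open>\<psi>\<^sup>2 - \<psi>\<close> stays in an open half plane not containing 0.  Such a
  rectangle has product measure zero, hence a null side, and the union of these sides exhibits the
  set as marginally null (\<open>idempotent_symbol_marginally\<close>).
\<close>

section \<open>Countable unions of rectangles\<close>

definition rectangles :: "'a measure \<Rightarrow> ('a \<times> 'a) set set" where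
  "rectangles M = {\<alpha> \<times> \<beta> | \<alpha> \<beta>. \<alpha> \<in> sets M \<and> \<beta> \<in> sets M}"

lemma rectanglesE:
  assumes "R \<in> rectangles M"
  obtains \<alpha> \<beta> where "R = \<alpha> \<times> \<beta>" "\<alpha> \<in> sets M" "\<beta> \<in> sets M"
  using assms unfolding rectangles_def by blast

lemma rectanglesI: "\<alpha> \<in> sets M \<Longrightarrow> \<beta> \<in> sets M \<Longrightarrow> \<alpha> \<times> \<beta> \<in> rectangles M"
  unfolding rectangles_def by blast

definition rect_open :: "'a measure \<Rightarrow> ('a \<times> 'a) set \<Rightarrow> bool" where
  "rect_open M E \<longleftrightarrow>
     (\<exists>F. countable F \<and> F \<subseteq> rectangles M \<and> E = \<Union>F)"

lemma rect_open_rectangle: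
  assumes "\<alpha> \<in> sets M" "\<beta> \<in> sets M"
  shows "rect_open M (\<alpha> \<times> \<beta>)"
  unfolding rect_open_def by (rule exI[of _ "{\<alpha> \<times> \<beta>}"]) (use assms rectanglesI in auto)

lemma rect_open_UN:
  assumes "countable I" "\<And>i. i \<in> I \<Longrightarrow> rect_open M (E i)"
  shows "rect_open M (\<Union>i\<in>I. E i)"
proof -
  have "\<forall>i\<in>I. \<exists>F. countable F \<and>
      F \<subseteq> rectangles M \<and> E i = \<Union>F"
    using assms(2) unfolding rect_open_def by simp
  from bchoice[OF this] obtain F where F: "\<And>i. i \<in> I \<Longrightarrow> countable (F i)"
      "\<And>i. i \<in> I \<Longrightarrow> F i \<subseteq> rectangles M"
      "\<And>i. i \<in> I \<Longrightarrow> E i = \<Union>(F i)"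
    by metis
  show ?thesis
    unfolding rect_open_def
  proof (intro exI conjI)
    show "countable (\<Union>i\<in>I. F i)" using assms(1) F(1) by (rule countable_UN)
    show "(\<Union>i\<in>I. F i) \<subseteq> rectangles M"
      by (rule UN_least) (rule F(2))
    show "(\<Union>i\<in>I. E i) = \<Union>(\<Union>i\<in>I. F i)" using F(3) by auto
  qed
qed

lemma rect_open_Int:
  assumes "rect_open M A" "rect_open M B"
  shows "rect_open M (A \<inter> B)"
proof -
  obtain F where F: "countable F" "F \<subseteq> rectangles M" "A = \<Union>F"
    using assms(1) unfolding rect_open_def by blast
  obtain G where G: "countable G" "G \<subseteq> rectangles M" "B = \<Union>G"
    using assms(2) unfolding rect_open_def by blast
  have eq: "A \<inter> B = (\<Union>p\<in>F \<times> G. fst p \<inter> snd p)" using F(3) G(3) by auto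
  have Int: "rect_open M (C \<inter> D)" if CD: "C \<in> F" "D \<in> G" for C D
  proof -
    obtain a b where "C = a \<times> b" "a \<in> sets M" "b \<in> sets M"
      using CD(1) F(2) rectanglesE by blast
    moreover obtain c d where "D = c \<times> d" "c \<in> sets M" "d \<in> sets M"
      using CD(2) G(2) rectanglesE by blast
    ultimately show ?thesis using rect_open_rectangle[of "a \<inter> c" M "b \<inter> d"] by (simp add: Times_Int_Times)
  qed
  show ?thesis
    unfolding eq
  proof (rule rect_open_UN)
    show "countable (F \<times> G)" using F(1) G(1) by simp
    show "rect_open M (fst p \<inter> snd p)" if "p \<in> F \<times> G" for p
      using Int[of "fst p" "snd p"] mem_Times_iff[of p F G] that by blast
  qed
qed

text \<open>The definition of \<^const>\<open>omega_open\<close> asks for sequences of sides.  An empty rectangle is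
  added to the family so that an empty family can be enumerated too.\<close>

lemma rect_open_imp_sequence:
  assumes "rect_open M E"
  obtains \<alpha> \<beta> :: "nat \<Rightarrow> 'a set"
    where "\<And>n. \<alpha> n \<in> sets M" "\<And>n. \<beta> n \<in> sets M" "E = (\<Union>n. \<alpha> n \<times> \<beta> n)"
proof -
  obtain F where F: "countable F" "F \<subseteq> rectangles M" "E = \<Union>F"
    using assms unfolding rect_open_def by blast
  define G where "G = insert ({} \<times> {}) F"
  have G: "countable G" "G \<noteq> {}" "E = \<Union>G" using F by (auto simp: G_def)
  have "\<exists>\<alpha> \<beta>. \<alpha> \<in> sets M \<and> \<beta> \<in> sets M \<and> from_nat_into G n = \<alpha> \<times> \<beta>" for n
  proof -
    have "from_nat_into G n \<in> G" using G(2) by (rule from_nat_into)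
    then consider "from_nat_into G n = {} \<times> {}" | "from_nat_into G n \<in> F"
      unfolding G_def by blast
    then show ?thesis
    proof cases
      case 1
      then show ?thesis by (meson sets.empty_sets)
    next
      case 2
      then show ?thesis by (rule rectanglesE[OF subsetD[OF F(2)]]) blast
    qed
  qed
  then obtain \<alpha> \<beta> where ab: "\<And>n. \<alpha> n \<in> sets M \<and> \<beta> n \<in> sets M \<and> from_nat_into G n = \<alpha> n \<times> \<beta> n"
    by metis
  have "E = (\<Union>n. from_nat_into G n)"
    using G range_from_nat_into by metis
  then show thesis using that[of \<alpha> \<beta>] ab by auto
qed

lemma marginally_null_subset: "marginally_null M R \<Longrightarrow> S \<subseteq> R \<Longrightarrow> marginally_null M S"
  unfolding marginally_null_def by blast

lemma marginally_null_Un: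
  assumes "marginally_null M R" "marginally_null M S"
  shows "marginally_null M (R \<union> S)"
proof -
  obtain N K where "N \<in> null_sets M" "R \<subseteq> (N \<times> space M) \<union> (space M \<times> N)"
    "K \<in> null_sets M" "S \<subseteq> (K \<times> space M) \<union> (space M \<times> K)"
    using assms unfolding marginally_null_def by blast
  then show ?thesis unfolding marginally_null_def
    by (intro bexI[of _ "N \<union> K"]) auto
qed

lemma omega_open_if_near_rect_open:
  assumes "E \<subseteq> space M \<times> space M" "rect_open M E'" "marginally_null M (sym_diff E E')"
  shows "omega_open M E"
proof -
  obtain \<alpha> \<beta> :: "nat \<Rightarrow> 'a set"
    where "\<And>n. \<alpha> n \<in> sets M" "\<And>n. \<beta> n \<in> sets M" "E' = (\<Union>n. \<alpha> n \<times> \<beta> n)"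
    using rect_open_imp_sequence[OF assms(2)] by metis
  then show ?thesis using assms(1,3) unfolding omega_open_def by blast
qed

text \<open>A countable family of rectangles, each with a null side, is covered by the union of the null
  sides.  This is the point where product-null can be upgraded to marginally null.\<close>

lemma marginally_null_rect_open:
  assumes E: "rect_open M E"
    and null: "\<And>\<alpha> \<beta>. \<lbrakk>\<alpha> \<in> sets M; \<beta> \<in> sets M; \<alpha> \<times> \<beta> \<subseteq> E\<rbrakk> \<Longrightarrow> \<alpha> \<in> null_sets M \<or> \<beta> \<in> null_sets M"
  shows "marginally_null M E"
proof -
  obtain \<alpha> \<beta> :: "nat \<Rightarrow> 'a set"
    where ab: "\<And>n. \<alpha> n \<in> sets M" "\<And>n. \<beta> n \<in> sets M" "E = (\<Union>n. \<alpha> n \<times> \<beta> n)"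
    using rect_open_imp_sequence[OF E] by metis
  define N where "N n = (if \<alpha> n \<in> null_sets M then \<alpha> n else \<beta> n)" for n
  have N: "N n \<in> null_sets M" for n
    using null[of "\<alpha> n" "\<beta> n"] ab unfolding N_def by auto
  have "\<alpha> n \<times> \<beta> n \<subseteq> (N n \<times> space M) \<union> (space M \<times> N n)" for n
    using sets.sets_into_space[OF ab(1)[of n]] sets.sets_into_space[OF ab(2)[of n]]
    unfolding N_def by auto
  then have "E \<subseteq> ((\<Union>n. N n) \<times> space M) \<union> (space M \<times> (\<Union>n. N n))"
    unfolding ab(3) by blast
  then show ?thesis unfolding marginally_null_def using N by blast
qed

section \<open>Functions continuous for the rectangle structure\<close>

text \<open>The countable unions of rectangles are closed under countable unions and finite
  intersections only, but for second countable targets this suffices for the usual calculus of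
  continuous functions.\<close>
definition rect_continuous :: "'a measure \<Rightarrow> ('a \<times> 'a \<Rightarrow> 'b::topological_space) \<Rightarrow> bool" where
  "rect_continuous M h \<longleftrightarrow> (\<forall>U. open U \<longrightarrow> rect_open M {z \<in> space M \<times> space M. h z \<in> U})"

lemma rect_continuousD:
  "rect_continuous M h \<Longrightarrow> open U \<Longrightarrow> rect_open M {z \<in> space M \<times> space M. h z \<in> U}"
  unfolding rect_continuous_def by blast

lemma rect_continuous_compose:
  fixes h :: "'a \<times> 'a \<Rightarrow> 'b::topological_space" and k :: "'b \<Rightarrow> 'c::topological_space"
  assumes "rect_continuous M h" "continuous_on UNIV k"
  shows "rect_continuous M (\<lambda>z. k (h z))"
  unfolding rect_continuous_def
proof (intro allI impI)
  fix U :: "'c set" assume "open U"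
  then have "open (k -` U)" using assms(2) by (simp add: open_vimage)
  from rect_continuousD[OF assms(1) this]
  show "rect_open M {z \<in> space M \<times> space M. k (h z) \<in> U}" by simp
qed

lemma rect_continuous_fst:
  assumes "f \<in> borel_measurable M"
  shows "rect_continuous M (\<lambda>z. f (fst z))"
  unfolding rect_continuous_def
proof (intro allI impI)
  fix U :: "'b set" assume "open U"
  then have "f -` U \<inter> space M \<in> sets M" using assms by (simp add: borel_open measurable_sets)
  from rect_open_rectangle[OF this sets.top]
  show "rect_open M {z \<in> space M \<times> space M. f (fst z) \<in> U}"
    by (rule back_subst[of "rect_open M"]) auto
qed

lemma rect_continuous_snd:
  assumes "f \<in> borel_measurable M"
  shows "rect_continuous M (\<lambda>z. f (snd z))"
  unfolding rect_continuous_def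
proof (intro allI impI)
  fix U :: "'b set" assume "open U"
  then have "f -` U \<inter> space M \<in> sets M" using assms by (simp add: borel_open measurable_sets)
  from rect_open_rectangle[OF sets.top this]
  show "rect_open M {z \<in> space M \<times> space M. f (snd z) \<in> U}"
    by (rule back_subst[of "rect_open M"]) auto
qed

lemma rect_continuous_Pair:
  fixes h :: "'a \<times> 'a \<Rightarrow> 'b::second_countable_topology"
    and k :: "'a \<times> 'a \<Rightarrow> 'c::second_countable_topology"
  assumes "rect_continuous M h" "rect_continuous M k"
  shows "rect_continuous M (\<lambda>z. (h z, k z))"
  unfolding rect_continuous_def
proof (intro allI impI)
  fix W :: "('b \<times> 'c) set" assume W: "open W"
  obtain B :: "'b set set" where B: "countable B" "topological_basis B"
    using ex_countable_basis by blast
  obtain C :: "'c set set" where C: "countable C" "topological_basis C"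
    using ex_countable_basis by blast
  define I where "I = {(b, c) \<in> B \<times> C. b \<times> c \<subseteq> W}"
  have "countable I"
    by (rule countable_subset[of _ "B \<times> C"]) (use B(1) C(1) in \<open>auto simp: I_def\<close>)
  have cover: "\<exists>p\<in>I. x \<in> fst p \<and> y \<in> snd p" if xy: "(x, y) \<in> W" for x y
  proof -
    obtain U V where "open U" "open V" "(x, y) \<in> U \<times> V" "U \<times> V \<subseteq> W"
      by (rule open_prod_elim[OF W xy])
    then obtain b c where "b \<in> B" "x \<in> b" "b \<subseteq> U" "c \<in> C" "y \<in> c" "c \<subseteq> V"
      using topological_basisE[OF B(2)] topological_basisE[OF C(2)] by (metis mem_Sigma_iff)
    then show ?thesis using \<open>U \<times> V \<subseteq> W\<close>
      by (intro bexI[of _ "(b, c)"]) (auto simp: I_def)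
  qed
  have sub: "(x, y) \<in> W" if "p \<in> I" "x \<in> fst p" "y \<in> snd p" for p x y
    using that unfolding I_def by auto
  have opens: "open (fst p)" "open (snd p)" if "p \<in> I" for p
    using that topological_basis_open[OF B(2)] topological_basis_open[OF C(2)]
    unfolding I_def by auto
  define E where "E p = {z \<in> space M \<times> space M. h z \<in> fst p} \<inter> {z \<in> space M \<times> space M. k z \<in> snd p}" for p
  have "rect_open M (E p)" if "p \<in> I" for p
    unfolding E_def
    by (intro rect_open_Int rect_continuousD[OF assms(1)] rect_continuousD[OF assms(2)] opens that)
  then have "rect_open M (\<Union>p\<in>I. E p)"
    using \<open>countable I\<close> by (intro rect_open_UN)
  moreover have "z \<in> (\<Union>p\<in>I. E p) \<longleftrightarrow> z \<in> {z \<in> space M \<times> space M. (h z, k z) \<in> W}" for z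
    using cover[of "h z" "k z"] sub[of _ "h z" "k z"] unfolding E_def by blast
  ultimately show "rect_open M {z \<in> space M \<times> space M. (h z, k z) \<in> W}"
    by (metis (no_types, lifting) set_eqI)
qed

lemma rect_continuous_compose2:
  fixes h :: "'a \<times> 'a \<Rightarrow> 'b::second_countable_topology"
    and k :: "'a \<times> 'a \<Rightarrow> 'c::second_countable_topology"
  assumes "rect_continuous M h" "rect_continuous M k" "continuous_on UNIV (\<lambda>p. F (fst p) (snd p))"
  shows "rect_continuous M (\<lambda>z. F (h z) (k z))"
  using rect_continuous_compose[OF rect_continuous_Pair[OF assms(1,2)] assms(3)] by simp

lemma rect_continuous_sum:
  fixes h :: "nat \<Rightarrow> 'a \<times> 'a \<Rightarrow> 'b::{second_countable_topology, real_normed_vector}"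
  assumes "\<And>n. rect_continuous M (h n)"
  shows "rect_continuous M (\<lambda>z. \<Sum>n<N. h n z)"
proof (induction N)
  case 0
  show ?case using rect_continuous_fst[of "\<lambda>_. 0" M] by simp
next
  case (Suc N)
  show ?case
    unfolding sum.lessThan_Suc
    by (rule rect_continuous_compose2[OF Suc assms]) (intro continuous_intros)
qed

text \<open>A pointwise limit keeps the property when the error is controlled by functions \<open>E\<close> that have
  it.  The value \<open>h z\<close> lies in an open set \<open>U\<close> exactly if some approximation \<open>H N z\<close> lies deeper
  inside \<open>U\<close> than the error bound \<open>E N z\<close>, and this is an open condition on the pair.\<close>

lemma rect_continuous_limit:
  fixes h :: "'a \<times> 'a \<Rightarrow> 'b::{second_countable_topology, metric_space}"
  assumes H: "\<And>N. rect_continuous M (H N)" and E: "\<And>N. rect_continuous M (E N)"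
    and bound: "\<And>N z. z \<in> space M \<times> space M \<Longrightarrow> dist (h z) (H N z) \<le> E N z"
    and lim: "\<And>z. z \<in> space M \<times> space M \<Longrightarrow> (\<lambda>N. E N z) \<longlonglongrightarrow> (0::real)"
  shows "rect_continuous M h"
  unfolding rect_continuous_def
proof (intro allI impI)
  fix U :: "'b set" assume U: "open U"
  show "rect_open M {z \<in> space M \<times> space M. h z \<in> U}"
    \<comment> \<open>\<^const>\<open>infdist\<close> to the empty set is 0, so the whole space needs its own case.\<close>
  proof (cases "U = UNIV")
    case True
    then show ?thesis using rect_open_rectangle[of "space M" M "space M"] by simp
  next
    case False
    then have ne: "- U \<noteq> {}" by auto
    define W where "W = {p :: 'b \<times> real. snd p < infdist (fst p) (- U)}"
    have "open W"
      unfolding W_def by (intro open_Collect_less continuous_intros)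
    have iff: "h z \<in> U \<longleftrightarrow> (\<exists>N. (H N z, E N z) \<in> W)" if z: "z \<in> space M \<times> space M" for z
    proof
      assume "h z \<in> U"
      then have pos: "0 < infdist (h z) (- U)"
        using U ne in_closed_iff_infdist_zero[of "- U" "h z"] infdist_nonneg[of "h z" "- U"]
        by (auto simp: closed_Compl order_less_le)
      then have "eventually (\<lambda>N. E N z < infdist (h z) (- U) / 2) sequentially"
        by (intro order_tendstoD(2)[OF lim[OF z]]) simp
      then obtain N where N: "E N z < infdist (h z) (- U) / 2"
        using eventually_happens' by (metis sequentially_bot)
      have "infdist (h z) (- U) \<le> infdist (H N z) (- U) + dist (h z) (H N z)"
        by (rule infdist_triangle)
      then have "E N z < infdist (H N z) (- U)" using N bound[OF z, of N] by linarith
      then show "\<exists>N. (H N z, E N z) \<in> W" unfolding W_def by auto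
    next
      assume "\<exists>N. (H N z, E N z) \<in> W"
      then obtain N where "E N z < infdist (H N z) (- U)" unfolding W_def by auto
      then have "dist (H N z) (h z) < infdist (H N z) (- U)"
        using bound[OF z, of N] by (simp add: dist_commute)
      then show "h z \<in> U" using infdist_le[of "h z" "- U" "H N z"] by fastforce
    qed
    have "rect_open M (\<Union>N. {z \<in> space M \<times> space M. (H N z, E N z) \<in> W})"
      by (intro rect_open_UN rect_continuousD[OF rect_continuous_Pair] H E \<open>open W\<close>) auto
    then show ?thesis
      by (rule back_subst[of "rect_open M"]) (use iff in blast)
  qed
qed

section \<open>Symbols as functions\<close>

definition symbol_sum :: "(nat \<Rightarrow> 'a \<Rightarrow> complex) \<Rightarrow> (nat \<Rightarrow> 'a \<Rightarrow> complex) \<Rightarrow> 'a \<times> 'a \<Rightarrow> complex" where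
  "symbol_sum f g = (\<lambda>(s, t). \<Sum>n. f n s * g n t)"

lemma norm_mult_le_half_squares:
  fixes a b :: complex
  shows "cmod (a * b) \<le> (cmod a)\<^sup>2 / 2 + (cmod b)\<^sup>2 / 2"
proof -
  have "0 \<le> (cmod a - cmod b)\<^sup>2" by simp
  then show ?thesis by (simp add: norm_mult power2_diff)
qed

lemma bounded_square_sumsD:
  assumes "bounded_square_sums M f"
  shows "f n \<in> borel_measurable M"
    and "s \<in> space M \<Longrightarrow> summable (\<lambda>n. (cmod (f n s))\<^sup>2)"
    and "\<exists>C. \<forall>s\<in>space M. (\<Sum>n. (cmod (f n s))\<^sup>2) \<le> C"
  using assms unfolding bounded_square_sums_def by auto

context
  fixes M :: "'a measure" and f g :: "nat \<Rightarrow> 'a \<Rightarrow> complex"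
  assumes f: "bounded_square_sums M f" and g: "bounded_square_sums M g"
begin

lemma summable_norm_symbol:
  assumes "s \<in> space M" "t \<in> space M"
  shows "summable (\<lambda>n. cmod (f n s * g n t))"
proof (rule summable_comparison_test')
  show "summable (\<lambda>n. (cmod (f n s))\<^sup>2 / 2 + (cmod (g n t))\<^sup>2 / 2)"
    using assms bounded_square_sumsD(2)[OF f] bounded_square_sumsD(2)[OF g]
    by (intro summable_add summable_divide) auto
  show "norm (cmod (f n s * g n t)) \<le> (cmod (f n s))\<^sup>2 / 2 + (cmod (g n t))\<^sup>2 / 2" for n
    using norm_mult_le_half_squares by simp
qed

lemma symbol_sum_sums:
  assumes "s \<in> space M" "t \<in> space M"
  shows "(\<lambda>n. f n s * g n t) sums symbol_sum f g (s, t)"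
  unfolding symbol_sum_def
  using summable_sums[OF summable_norm_cancel[OF summable_norm_symbol[OF assms]]] by simp

lemma symbol_sum_measurable: "symbol_sum f g \<in> borel_measurable (M \<Otimes>\<^sub>M M)"
proof -
  note [measurable] = bounded_square_sumsD(1)[OF f] bounded_square_sumsD(1)[OF g]
  show ?thesis unfolding symbol_sum_def split_beta' by measurable
qed

lemma partial_sums_bounded:
  "\<exists>C. \<forall>s\<in>space M. \<forall>t\<in>space M. \<forall>N. cmod (\<Sum>n<N. f n s * g n t) \<le> C"
proof -
  obtain C D where C: "\<forall>s\<in>space M. (\<Sum>n. (cmod (f n s))\<^sup>2) \<le> C"
    and D: "\<forall>s\<in>space M. (\<Sum>n. (cmod (g n s))\<^sup>2) \<le> D"
    using bounded_square_sumsD(3)[OF f] bounded_square_sumsD(3)[OF g] by blast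
  have "cmod (\<Sum>n<N. f n s * g n t) \<le> C / 2 + D / 2" if st: "s \<in> space M" "t \<in> space M" for s t N
  proof -
    have "cmod (\<Sum>n<N. f n s * g n t) \<le> (\<Sum>n<N. (cmod (f n s))\<^sup>2 / 2 + (cmod (g n t))\<^sup>2 / 2)"
      by (intro order_trans[OF norm_sum] sum_mono norm_mult_le_half_squares)
    also have "\<dots> = (\<Sum>n<N. (cmod (f n s))\<^sup>2) / 2 + (\<Sum>n<N. (cmod (g n t))\<^sup>2) / 2"
      by (simp add: sum.distrib sum_divide_distrib)
    also have "\<dots> \<le> (\<Sum>n. (cmod (f n s))\<^sup>2) / 2 + (\<Sum>n. (cmod (g n t))\<^sup>2) / 2"
      using st bounded_square_sumsD(2)[OF f] bounded_square_sumsD(2)[OF g]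
      by (intro add_mono divide_right_mono sum_le_suminf) auto
    also have "\<dots> \<le> C / 2 + D / 2"
      using C D st by (intro add_mono divide_right_mono) auto
    finally show ?thesis .
  qed
  then show ?thesis by blast
qed

lemma symbol_sum_bounded:
  "\<exists>C. \<forall>z\<in>space M \<times> space M. cmod (symbol_sum f g z) \<le> C"
proof -
  obtain C where C: "\<And>s t N. s \<in> space M \<Longrightarrow> t \<in> space M \<Longrightarrow> cmod (\<Sum>n<N. f n s * g n t) \<le> C"
    using partial_sums_bounded by blast
  have "cmod (symbol_sum f g (s, t)) \<le> C" if st: "s \<in> space M" "t \<in> space M" for s t
  proof (rule tendsto_upperbound)
    show "(\<lambda>N. cmod (\<Sum>n<N. f n s * g n t)) \<longlonglongrightarrow> cmod (symbol_sum f g (s, t))"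
      using symbol_sum_sums[OF st] unfolding sums_def by (rule tendsto_norm)
  qed (use C[OF st] in auto)
  then show ?thesis by auto
qed

text \<open>The tail of the series is at most half the tail of \<open>\<Sum>|f\<^sub>n(s)|\<^sup>2\<close> plus half the tail of
  \<open>\<Sum>|g\<^sub>n(t)|\<^sup>2\<close>.  Using this sum instead of the Cauchy-Schwarz product keeps the error a sum of
  functions of one variable.\<close>

lemma rect_continuous_symbol_sum: "rect_continuous M (symbol_sum f g)"
proof -
  define F where "F N s = (\<Sum>n. (cmod (f (n + N) s))\<^sup>2) / 2" for N s
  define G where "G N t = (\<Sum>n. (cmod (g (n + N) t))\<^sup>2) / 2" for N t
  have [measurable]: "F N \<in> borel_measurable M" "G N \<in> borel_measurable M" for N
    unfolding F_def G_def using bounded_square_sumsD(1)[OF f] bounded_square_sumsD(1)[OF g] by auto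
  show ?thesis
  proof (rule rect_continuous_limit)
    show "rect_continuous M (\<lambda>z. \<Sum>n<N. f n (fst z) * g n (snd z))" for N
      by (intro rect_continuous_sum rect_continuous_compose2[where F="(*)"]
          rect_continuous_fst rect_continuous_snd continuous_intros
          bounded_square_sumsD(1)[OF f] bounded_square_sumsD(1)[OF g])
    show "rect_continuous M (\<lambda>z. F N (fst z) + G N (snd z))" for N
      by (intro rect_continuous_compose2[where F="(+)"]
          rect_continuous_fst rect_continuous_snd continuous_intros) auto
  next
    fix N and z :: "'a \<times> 'a" assume z: "z \<in> space M \<times> space M"
    obtain s t where zst: "z = (s, t)" and st: "s \<in> space M" "t \<in> space M" using z by auto
    have sf: "summable (\<lambda>n. (cmod (f (n + N) s))\<^sup>2 / 2)"
      using bounded_square_sumsD(2)[OF f st(1)] summable_iff_shift[of "\<lambda>n. (cmod (f n s))\<^sup>2" N]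
      by (intro summable_divide) simp
    have sg: "summable (\<lambda>n. (cmod (g (n + N) t))\<^sup>2 / 2)"
      using bounded_square_sumsD(2)[OF g st(2)] summable_iff_shift[of "\<lambda>n. (cmod (g n t))\<^sup>2" N]
      by (intro summable_divide) simp
    have sn: "summable (\<lambda>n. cmod (f (n + N) s * g (n + N) t))"
      using summable_norm_symbol[OF st] summable_iff_shift[of "\<lambda>n. cmod (f n s * g n t)" N] by simp
    have "symbol_sum f g z - (\<Sum>n<N. f n s * g n t) = (\<Sum>n. f (n + N) s * g (n + N) t)"
      using suminf_split_initial_segment[OF summable_norm_cancel[OF summable_norm_symbol[OF st]], of N]
      unfolding zst symbol_sum_def by simp
    then have "dist (symbol_sum f g z) (\<Sum>n<N. f n s * g n t) \<le> (\<Sum>n. cmod (f (n + N) s * g (n + N) t))"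
      using summable_norm[OF sn] by (simp add: dist_norm)
    also have "\<dots> \<le> (\<Sum>n. (cmod (f (n + N) s))\<^sup>2 / 2 + (cmod (g (n + N) t))\<^sup>2 / 2)"
      by (intro suminf_le norm_mult_le_half_squares sn summable_add sf sg)
    also have "\<dots> = F N s + G N t"
      unfolding F_def G_def suminf_add[OF sf sg, symmetric]
      using bounded_square_sumsD(2)[OF f st(1)] summable_iff_shift[of "\<lambda>n. (cmod (f n s))\<^sup>2" N]
        bounded_square_sumsD(2)[OF g st(2)] summable_iff_shift[of "\<lambda>n. (cmod (g n t))\<^sup>2" N]
      by (simp add: suminf_divide)
    finally show "dist (symbol_sum f g z) (\<Sum>n<N. f n (fst z) * g n (snd z)) \<le> F N (fst z) + G N (snd z)"
      unfolding zst by simp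
  next
    fix z :: "'a \<times> 'a" assume z: "z \<in> space M \<times> space M"
    have "(\<lambda>N. F N (fst z) + G N (snd z)) \<longlonglongrightarrow> 0 / 2 + 0 / 2"
      unfolding F_def G_def using z
      by (intro tendsto_add tendsto_divide tendsto_const suminf_exist_split2
          bounded_square_sumsD(2)[OF f] bounded_square_sumsD(2)[OF g]) auto
    then show "(\<lambda>N. F N (fst z) + G N (snd z)) \<longlonglongrightarrow> 0" by simp
  qed
qed

end

section \<open>Vectors through representatives\<close>

text \<open>Boundedness is required everywhere on the space rather than almost everywhere, so that the
  bounds pass to functions of two variables point by point.\<close>
definition bounded_measurable :: "'a measure \<Rightarrow> ('a \<Rightarrow> complex) set" where
  "bounded_measurable M = {u \<in> borel_measurable M. \<exists>C. \<forall>x\<in>space M. cmod (u x) \<le> C}"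

lemma bounded_measurableD: "u \<in> bounded_measurable M \<Longrightarrow> u \<in> borel_measurable M"
  unfolding bounded_measurable_def by simp

lemma bounded_measurable_mult:
  assumes "u \<in> bounded_measurable M" "v \<in> bounded_measurable M"
  shows "(\<lambda>x. u x * v x) \<in> bounded_measurable M"
proof -
  obtain C D where C: "\<And>x. x \<in> space M \<Longrightarrow> cmod (u x) \<le> C"
    and D: "\<And>x. x \<in> space M \<Longrightarrow> cmod (v x) \<le> D"
    using assms unfolding bounded_measurable_def by blast
  have "cmod (u x * v x) \<le> C * D" if "x \<in> space M" for x
    unfolding norm_mult using C[OF that] D[OF that] by (intro mult_mono') auto
  then show ?thesis
    using assms unfolding bounded_measurable_def by auto
qed

lemma bounded_measurable_const: "(\<lambda>x. c) \<in> bounded_measurable M"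
  unfolding bounded_measurable_def by auto

lemma bounded_measurable_add:
  assumes "u \<in> bounded_measurable M" "v \<in> bounded_measurable M"
  shows "(\<lambda>x. u x + v x) \<in> bounded_measurable M"
proof -
  obtain C D where C: "\<And>x. x \<in> space M \<Longrightarrow> cmod (u x) \<le> C"
    and D: "\<And>x. x \<in> space M \<Longrightarrow> cmod (v x) \<le> D"
    using assms unfolding bounded_measurable_def by blast
  have "cmod (u x + v x) \<le> C + D" if "x \<in> space M" for x
    using norm_triangle_ineq[of "u x" "v x"] C[OF that] D[OF that] by linarith
  then show ?thesis
    using assms unfolding bounded_measurable_def by auto
qed

lemma borel_measurable_cnj:
  assumes "f \<in> borel_measurable M"
  shows "(\<lambda>x. cnj (f x)) \<in> borel_measurable M"
  by (rule borel_measurable_continuous_on[OF _ assms]) (intro continuous_intros)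

lemma bounded_measurable_cnj:
  "u \<in> bounded_measurable M \<Longrightarrow> (\<lambda>x. cnj (u x)) \<in> bounded_measurable M"
  unfolding bounded_measurable_def by (auto intro: borel_measurable_cnj)

lemma bounded_measurable_square_sums:
  assumes "bounded_square_sums M f"
  shows "f n \<in> bounded_measurable M"
proof -
  obtain C where C: "\<forall>s\<in>space M. (\<Sum>n. (cmod (f n s))\<^sup>2) \<le> C"
    using bounded_square_sumsD(3)[OF assms] by blast
  have "cmod (f n s) \<le> sqrt C" if s: "s \<in> space M" for s
  proof (rule real_le_rsqrt)
    have "(cmod (f n s))\<^sup>2 \<le> (\<Sum>n. (cmod (f n s))\<^sup>2)"
      using sum_le_suminf[OF bounded_square_sumsD(2)[OF assms s], of "{n}"] by simp
    then show "(cmod (f n s))\<^sup>2 \<le> C" using C s by force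
  qed
  then show ?thesis
    using bounded_square_sumsD(1)[OF assms] unfolding bounded_measurable_def by blast
qed

lemma sq_integrableD:
  assumes "f \<in> sq_integrable M"
  shows "f \<in> borel_measurable M" "integrable M (\<lambda>x. (cmod (f x))\<^sup>2)"
  using assms unfolding sq_integrable_def by auto

lemma sq_integrable_dominated:
  assumes "f \<in> borel_measurable M" "integrable M h" "\<And>x. x \<in> space M \<Longrightarrow> (cmod (f x))\<^sup>2 \<le> h x"
  shows "f \<in> sq_integrable M"
proof -
  have "integrable M (\<lambda>x. (cmod (f x))\<^sup>2)"
    by (rule Bochner_Integration.integrable_bound[OF assms(2)])
      (use assms(1,3) in \<open>auto intro!: AE_I2 intro: order_trans[OF _ abs_ge_self]\<close>)
  then show ?thesis using assms(1) unfolding sq_integrable_def by simp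
qed

lemma sq_integrable_bounded_mult:
  assumes "u \<in> bounded_measurable M" "f \<in> sq_integrable M"
  shows "(\<lambda>x. u x * f x) \<in> sq_integrable M"
proof -
  obtain C where C: "\<And>x. x \<in> space M \<Longrightarrow> cmod (u x) \<le> C"
    using assms(1) unfolding bounded_measurable_def by blast
  show ?thesis
  proof (rule sq_integrable_dominated)
    show "(\<lambda>x. u x * f x) \<in> borel_measurable M"
      using bounded_measurableD[OF assms(1)] sq_integrableD(1)[OF assms(2)] by simp
    show "integrable M (\<lambda>x. C\<^sup>2 * (cmod (f x))\<^sup>2)"
      using sq_integrableD(2)[OF assms(2)] by simp
    show "(cmod (u x * f x))\<^sup>2 \<le> C\<^sup>2 * (cmod (f x))\<^sup>2" if "x \<in> space M" for x
      unfolding norm_mult power_mult_distrib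
      by (intro mult_right_mono power_mono C that) auto
  qed
qed

lemma sq_integrable_scale: "f \<in> sq_integrable M \<Longrightarrow> (\<lambda>x. c * f x) \<in> sq_integrable M"
  by (intro sq_integrable_bounded_mult bounded_measurable_const)

lemma sq_integrable_add:
  assumes "f \<in> sq_integrable M" "g \<in> sq_integrable M"
  shows "(\<lambda>x. f x + g x) \<in> sq_integrable M"
proof (rule sq_integrable_dominated)
  show "(\<lambda>x. f x + g x) \<in> borel_measurable M"
    using sq_integrableD(1)[OF assms(1)] sq_integrableD(1)[OF assms(2)] by simp
  show "integrable M (\<lambda>x. 2 * (cmod (f x))\<^sup>2 + 2 * (cmod (g x))\<^sup>2)"
    using sq_integrableD(2)[OF assms(1)] sq_integrableD(2)[OF assms(2)] by simp
  show "(cmod (f x + g x))\<^sup>2 \<le> 2 * (cmod (f x))\<^sup>2 + 2 * (cmod (g x))\<^sup>2" for x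
  proof -
    have "(cmod (f x + g x))\<^sup>2 \<le> (cmod (f x) + cmod (g x))\<^sup>2"
      by (intro power_mono norm_triangle_ineq) simp
    also have "\<dots> \<le> 2 * (cmod (f x))\<^sup>2 + 2 * (cmod (g x))\<^sup>2"
      using zero_le_power2[of "cmod (f x) - cmod (g x)"]
      unfolding power2_sum power2_diff by linarith
    finally show ?thesis .
  qed
qed

lemma integrable_sq_integrable_mult:
  assumes "f \<in> sq_integrable M" "g \<in> sq_integrable M"
  shows "integrable M (\<lambda>x. f x * g x)"
proof (rule Bochner_Integration.integrable_bound)
  show "integrable M (\<lambda>x. (cmod (f x))\<^sup>2 / 2 + (cmod (g x))\<^sup>2 / 2)"
    using sq_integrableD(2)[OF assms(1)] sq_integrableD(2)[OF assms(2)] by simp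
  show "(\<lambda>x. f x * g x) \<in> borel_measurable M"
    using sq_integrableD(1)[OF assms(1)] sq_integrableD(1)[OF assms(2)] by simp
  show "AE x in M. norm (f x * g x) \<le> norm ((cmod (f x))\<^sup>2 / 2 + (cmod (g x))\<^sup>2 / 2)"
    using norm_mult_le_half_squares by (intro AE_I2) (metis abs_ge_self order_trans real_norm_def)
qed

lemma sq_integrable_cnj: "f \<in> sq_integrable M \<Longrightarrow> (\<lambda>x. cnj (f x)) \<in> sq_integrable M"
  unfolding sq_integrable_def by (auto intro: borel_measurable_cnj)

lemma equiv_ae_rel: "equiv (sq_integrable M) (ae_rel M)"
proof (rule equivI)
  show "ae_rel M \<subseteq> sq_integrable M \<times> sq_integrable M" by (auto simp: ae_rel_def)
  show "refl_on (sq_integrable M) (ae_rel M)" by (auto simp: refl_on_def ae_rel_def)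
  show "sym (ae_rel M)" by (auto simp: sym_def ae_rel_def eq_commute)
  show "trans (ae_rel M)" by (auto simp: trans_def ae_rel_def elim: AE_mp)
qed

lemma l2_class_in_L2: "f \<in> sq_integrable M \<Longrightarrow> l2_class M f \<in> L2 M"
  unfolding l2_class_def L2_def by (rule quotientI)

lemma l2_class_cong:
  assumes "f \<in> sq_integrable M" "g \<in> sq_integrable M" "AE x in M. f x = g x"
  shows "l2_class M f = l2_class M g"
  unfolding l2_class_def
  by (rule equiv_class_eq[OF equiv_ae_rel]) (use assms in \<open>simp add: ae_rel_def\<close>)

lemma l2_rep_class:
  assumes "f \<in> sq_integrable M"
  shows "l2_rep (l2_class M f) \<in> sq_integrable M" "AE x in M. l2_rep (l2_class M f) x = f x"
proof -
  have "f \<in> l2_class M f" using assms by (simp add: l2_class_def ae_rel_def)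
  then have "l2_rep (l2_class M f) \<in> l2_class M f"
    unfolding l2_rep_def by (rule someI[where P="\<lambda>h. h \<in> l2_class M f"])
  moreover have "h \<in> sq_integrable M \<and> (AE x in M. h x = f x)" if "h \<in> l2_class M f" for h
    using that by (simp add: l2_class_def ae_rel_def eq_commute)
  ultimately show "l2_rep (l2_class M f) \<in> sq_integrable M" "AE x in M. l2_rep (l2_class M f) x = f x"
    by blast+
qed

lemma L2E:
  assumes "\<xi> \<in> L2 M"
  obtains f where "f \<in> sq_integrable M" "\<xi> = l2_class M f"
  using assms unfolding L2_def l2_class_def by (auto elim: quotientE)

lemma l2_rep_in: "\<xi> \<in> L2 M \<Longrightarrow> l2_rep \<xi> \<in> sq_integrable M"
  by (metis L2E l2_rep_class(1))

lemma l2_add_class: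
  assumes "f \<in> sq_integrable M" "g \<in> sq_integrable M"
  shows "l2_add M (l2_class M f) (l2_class M g) = l2_class M (\<lambda>x. f x + g x)"
  unfolding l2_add_def
proof (rule l2_class_cong)
  show "AE x in M. l2_rep (l2_class M f) x + l2_rep (l2_class M g) x = f x + g x"
    using l2_rep_class(2)[OF assms(1)] l2_rep_class(2)[OF assms(2)] by eventually_elim simp
qed (intro sq_integrable_add l2_rep_class assms)+

lemma l2_scale_class:
  assumes "f \<in> sq_integrable M"
  shows "l2_scale M c (l2_class M f) = l2_class M (\<lambda>x. c * f x)"
  unfolding l2_scale_def
proof (rule l2_class_cong)
  show "AE x in M. c * l2_rep (l2_class M f) x = c * f x"
    using l2_rep_class(2)[OF assms] by eventually_elim simp
qed (intro sq_integrable_scale l2_rep_class assms)+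

lemma l2_inner_class:
  assumes "f \<in> sq_integrable M" "g \<in> sq_integrable M"
  shows "l2_inner M (l2_class M f) (l2_class M g) = (LINT x|M. f x * cnj (g x))"
  unfolding l2_inner_def
proof (rule integral_cong_AE)
  show "(\<lambda>x. l2_rep (l2_class M f) x * cnj (l2_rep (l2_class M g) x)) \<in> borel_measurable M"
    by (intro borel_measurable_times borel_measurable_cnj sq_integrableD l2_rep_class assms)
  show "(\<lambda>x. f x * cnj (g x)) \<in> borel_measurable M"
    by (intro borel_measurable_times borel_measurable_cnj sq_integrableD assms)
  show "AE x in M. l2_rep (l2_class M f) x * cnj (l2_rep (l2_class M g) x) = f x * cnj (g x)"
    using l2_rep_class(2)[OF assms(1)] l2_rep_class(2)[OF assms(2)] by eventually_elim simp
qed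

lemma l2_norm_class:
  assumes "f \<in> sq_integrable M"
  shows "l2_norm M (l2_class M f) = sqrt (LINT x|M. (cmod (f x))\<^sup>2)"
  unfolding l2_norm_def
proof (rule arg_cong[where f=sqrt], rule integral_cong_AE)
  show "AE x in M. (cmod (l2_rep (l2_class M f) x))\<^sup>2 = (cmod (f x))\<^sup>2"
    using l2_rep_class(2)[OF assms] by eventually_elim simp
qed (use assms l2_rep_class(1)[OF assms] in \<open>auto simp: sq_integrable_def\<close>)

lemma mult_op_class:
  assumes "u \<in> bounded_measurable M" "f \<in> sq_integrable M"
  shows "mult_op M u (l2_class M f) = l2_class M (\<lambda>x. u x * f x)"
proof -
  have "l2_class M (\<lambda>x. u x * l2_rep (l2_class M f) x) = l2_class M (\<lambda>x. u x * f x)"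
  proof (rule l2_class_cong)
    show "AE x in M. u x * l2_rep (l2_class M f) x = u x * f x"
      using l2_rep_class(2)[OF assms(2)] by eventually_elim simp
  qed (intro sq_integrable_bounded_mult l2_rep_class assms)+
  then show ?thesis using assms(2) by (simp add: mult_op_def l2_class_in_L2)
qed

lemma l2_inner_add_left:
  assumes "\<xi> \<in> L2 M" "\<xi>' \<in> L2 M" "\<eta> \<in> L2 M"
  shows "l2_inner M (l2_add M \<xi> \<xi>') \<eta> = l2_inner M \<xi> \<eta> + l2_inner M \<xi>' \<eta>"
proof -
  obtain f f' g where fg: "f \<in> sq_integrable M" "f' \<in> sq_integrable M" "g \<in> sq_integrable M"
    and eq: "\<xi> = l2_class M f" "\<xi>' = l2_class M f'" "\<eta> = l2_class M g"
    using assms by (elim L2E)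
  note int = integrable_sq_integrable_mult[OF _ sq_integrable_cnj[OF fg(3)]]
  show ?thesis
    unfolding eq using fg int[OF fg(1)] int[OF fg(2)]
    by (simp add: l2_add_class l2_inner_class sq_integrable_add distrib_right)
qed

lemma l2_inner_mult_op_left:
  assumes "u \<in> bounded_measurable M" "\<xi> \<in> L2 M" "g \<in> sq_integrable M"
  shows "l2_inner M (mult_op M u \<xi>) (l2_class M g) = l2_inner M \<xi> (l2_class M (\<lambda>x. cnj (u x) * g x))"
proof -
  obtain f where f: "f \<in> sq_integrable M" "\<xi> = l2_class M f" using assms(2) by (rule L2E)
  have "l2_inner M (mult_op M u \<xi>) (l2_class M g) = (LINT x|M. u x * f x * cnj (g x))"
    unfolding f(2) mult_op_class[OF assms(1) f(1)]
    by (rule l2_inner_class[OF sq_integrable_bounded_mult[OF assms(1) f(1)] assms(3)])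
  also have "\<dots> = (LINT x|M. f x * cnj (cnj (u x) * g x))" by (simp add: ac_simps)
  also have "\<dots> = l2_inner M \<xi> (l2_class M (\<lambda>x. cnj (u x) * g x))"
    unfolding f(2)
    by (rule l2_inner_class[symmetric])
      (intro f sq_integrable_bounded_mult bounded_measurable_cnj assms)+
  finally show ?thesis .
qed

lemma zero_sq_integrable: "(\<lambda>x. 0) \<in> sq_integrable M"
  by (simp add: sq_integrable_def)

lemma l2_zero_in: "l2_zero M \<in> L2 M"
  unfolding l2_zero_def by (intro l2_class_in_L2 zero_sq_integrable)

lemma l2_inner_zero_right: "\<xi> \<in> L2 M \<Longrightarrow> l2_inner M \<xi> (l2_zero M) = 0"
  unfolding l2_zero_def by (elim L2E) (simp add: l2_inner_class zero_sq_integrable)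

lemma l2_inner_zero_left: "\<xi> \<in> L2 M \<Longrightarrow> l2_inner M (l2_zero M) \<xi> = 0"
  unfolding l2_zero_def by (elim L2E) (simp add: l2_inner_class zero_sq_integrable)

lemma l2_norm_zero: "l2_norm M (l2_zero M) = 0"
  unfolding l2_zero_def by (simp add: l2_norm_class zero_sq_integrable)

section \<open>Matrix coefficients\<close>

lemma bounded_opsD:
  assumes "T \<in> bounded_ops M" "\<xi> \<in> L2 M"
  shows "T \<xi> \<in> L2 M"
  using assms unfolding bounded_ops_def by auto

text \<open>A single pair of vectors, padded by zero vectors, is a square summable pair of sequences, so
  matrix coefficients are among the functionals that define the weak-star topology.\<close>

lemma weak_star_limit_imp_weak_limit:
  assumes lim: "limitin (weak_star M) S T sequentially" and \<xi>: "\<xi> \<in> L2 M" and \<eta>: "\<eta> \<in> L2 M"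
  shows "(\<lambda>n. l2_inner M (S n \<xi>) \<eta>) \<longlonglongrightarrow> l2_inner M (T \<xi>) \<eta>"
proof (rule topological_tendstoI)
  fix U :: "complex set" assume U: "open U" "l2_inner M (T \<xi>) \<eta> \<in> U"
  define \<xi>' where "\<xi>' n = (if n = (0::nat) then \<xi> else l2_zero M)" for n
  define \<eta>' where "\<eta>' n = (if n = (0::nat) then \<eta> else l2_zero M)" for n
  have vec: "\<xi>' \<in> sq_summable_vectors M" "\<eta>' \<in> sq_summable_vectors M"
    unfolding sq_summable_vectors_def \<xi>'_def \<eta>'_def
    using \<xi> \<eta> l2_zero_in by (auto intro!: summable_finite[of "{0}"] simp: l2_norm_zero split: if_splits)
  have functional: "predual_functional M \<xi>' \<eta>' R = l2_inner M (R \<xi>) \<eta>" if R: "R \<in> bounded_ops M" for R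
  proof -
    have "predual_functional M \<xi>' \<eta>' R = (\<Sum>n\<in>{0}. l2_inner M (R (\<xi>' n)) (\<eta>' n))"
      unfolding predual_functional_def
      by (rule suminf_finite)
        (use bounded_opsD[OF R l2_zero_in] in \<open>auto simp: \<xi>'_def \<eta>'_def l2_inner_zero_right\<close>)
    then show ?thesis by (simp add: \<xi>'_def \<eta>'_def)
  qed
  have op: "openin (weak_star M) {R \<in> bounded_ops M. predual_functional M \<xi>' \<eta>' R \<in> U}"
    unfolding weak_star_def
    by (rule topology_generated_by_Basis) (use vec U(1) in blast)
  have "topspace (weak_star M) \<subseteq> bounded_ops M"
    unfolding weak_star_def topology_generated_by_topspace by auto
  then have T: "T \<in> bounded_ops M" using limitin_topspace[OF lim] by blast
  have "T \<in> {R \<in> bounded_ops M. predual_functional M \<xi>' \<eta>' R \<in> U}"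
    using T U(2) functional[OF T] by simp
  then have "\<forall>\<^sub>F n in sequentially. S n \<in> {R \<in> bounded_ops M. predual_functional M \<xi>' \<eta>' R \<in> U}"
    using lim op unfolding limitin_def by blast
  then show "\<forall>\<^sub>F n in sequentially. l2_inner M (S n \<xi>) \<eta> \<in> U"
    by eventually_elim (use functional in force)
qed

lemma l2_inner_op_sum:
  assumes S: "\<And>k. S k \<xi> \<in> L2 M" and \<xi>: "\<xi> \<in> L2 M" and \<eta>: "\<eta> \<in> L2 M"
  shows "l2_inner M (op_sum M S n \<xi>) \<eta> = (\<Sum>k<n. l2_inner M (S k \<xi>) \<eta>)"
proof -
  have "op_sum M S n \<xi> \<in> L2 M \<and> l2_inner M (op_sum M S n \<xi>) \<eta> = (\<Sum>k<n. l2_inner M (S k \<xi>) \<eta>)"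
  proof (induction n)
    case 0
    show ?case using \<xi> \<eta> by (simp add: op_zero_def l2_zero_in l2_inner_zero_left)
  next
    case (Suc n)
    have "l2_add M (op_sum M S n \<xi>) (S n \<xi>) \<in> L2 M"
      unfolding l2_add_def using Suc S by (intro l2_class_in_L2 sq_integrable_add l2_rep_in) auto
    then show ?case
      using Suc S \<xi> \<eta> by (simp add: op_add_def l2_inner_add_left)
  qed
  then show ?thesis ..
qed

text \<open>The second function is conjugated so that the coefficient is bilinear in \<open>u\<close> and \<open>v\<close>;
  a multiplication operator then moves across without conjugates.\<close>
definition coefficient ::
  "'a measure \<Rightarrow> 'a l2_op \<Rightarrow> ('a \<Rightarrow> complex) \<Rightarrow> ('a \<Rightarrow> complex) \<Rightarrow> complex" where
  "coefficient M T u v = l2_inner M (T (l2_class M u)) (l2_class M (\<lambda>x. cnj (v x)))"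

context finite_measure
begin

lemma bounded_sq_integrable: "u \<in> bounded_measurable M \<Longrightarrow> u \<in> sq_integrable M"
  using sq_integrable_bounded_mult[of u M "\<lambda>_. 1"] by (simp add: sq_integrable_def)

text \<open>The multiplication operators on both sides of \<open>T\<close> are absorbed into the two functions, and
  weak-star convergence of the series is tested on one coefficient.\<close>

lemma coefficient_sums:
  assumes rep: "represents M \<Phi> f g" and T: "T \<in> bounded_ops M"
    and u: "u \<in> bounded_measurable M" and v: "v \<in> bounded_measurable M"
  shows "(\<lambda>n. coefficient M T (\<lambda>x. g n x * u x) (\<lambda>x. f n x * v x)) sums coefficient M (\<Phi> T) u v"
proof -
  have f: "f n \<in> bounded_measurable M" and g: "g n \<in> bounded_measurable M" for n
    using rep bounded_measurable_square_sums unfolding represents_def by blast+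
  define S where "S n = op_mult M (mult_op M (f n)) (op_mult M T (mult_op M (g n)))" for n
  define \<xi> where "\<xi> = l2_class M u"
  define \<eta> where "\<eta> = l2_class M (\<lambda>x. cnj (v x))"
  have u': "u \<in> sq_integrable M" and v': "(\<lambda>x. cnj (v x)) \<in> sq_integrable M"
    using u v by (auto intro: bounded_sq_integrable bounded_measurable_cnj)
  have \<xi>: "\<xi> \<in> L2 M" and \<eta>: "\<eta> \<in> L2 M"
    unfolding \<xi>_def \<eta>_def by (intro l2_class_in_L2 u' v')+
  have Tg: "T (l2_class M (\<lambda>x. g n x * u x)) \<in> L2 M" for n
    by (intro bounded_opsD[OF T] l2_class_in_L2 sq_integrable_bounded_mult g u')
  have S\<xi>: "S n \<xi> = mult_op M (f n) (T (l2_class M (\<lambda>x. g n x * u x)))" for n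
    using \<xi> g u' unfolding S_def op_mult_def by (simp add: compose_eq \<xi>_def mult_op_class)
  have SL2: "S n \<xi> \<in> L2 M" for n
    unfolding S\<xi> mult_op_def using Tg
    by (auto intro!: l2_class_in_L2 sq_integrable_bounded_mult f l2_rep_in)
  have "l2_inner M (S n \<xi>) \<eta> = coefficient M T (\<lambda>x. g n x * u x) (\<lambda>x. f n x * v x)" for n
    unfolding S\<xi> \<eta>_def l2_inner_mult_op_left[OF f Tg v'] coefficient_def by simp
  then have "(\<lambda>N. \<Sum>n<N. coefficient M T (\<lambda>x. g n x * u x) (\<lambda>x. f n x * v x))
      = (\<lambda>N. l2_inner M (op_sum M S N \<xi>) \<eta>)"
    using l2_inner_op_sum[of S \<xi> M \<eta>, OF SL2 \<xi> \<eta>] by simp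
  moreover have "limitin (weak_star M) (op_sum M S) (\<Phi> T) sequentially"
    using rep T unfolding represents_def S_def by blast
  ultimately show ?thesis
    using weak_star_limit_imp_weak_limit[OF _ \<xi> \<eta>]
    unfolding sums_def coefficient_def[of M "\<Phi> T"] \<xi>_def[symmetric] \<eta>_def[symmetric] by simp
qed

section \<open>The rank-one operator onto the constants\<close>

text \<open>The orthogonal projection onto the constants, times the total mass: this normalisation gives
  the integral kernel 1, from which the symbol can be read off.\<close>
definition const_projection :: "'a l2_op" where
  "const_projection = (\<lambda>\<xi>\<in>L2 M. l2_class M (\<lambda>x. LINT y|M. l2_rep \<xi> y))"

lemma const_sq_integrable: "(\<lambda>x. c) \<in> sq_integrable M"
  by (intro bounded_sq_integrable bounded_measurable_const)

lemma integrable_sq_integrable: "f \<in> sq_integrable M \<Longrightarrow> integrable M f"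
  using integrable_sq_integrable_mult[OF const_sq_integrable[of 1]] by simp

lemma const_projection_class:
  assumes "f \<in> sq_integrable M"
  shows "const_projection (l2_class M f) = l2_class M (\<lambda>x. LINT y|M. f y)"
proof -
  have "(LINT y|M. l2_rep (l2_class M f) y) = (LINT y|M. f y)"
    by (rule integral_cong_AE)
      (use assms l2_rep_class[OF assms] in \<open>auto simp: sq_integrable_def\<close>)
  then show ?thesis using assms by (simp add: const_projection_def l2_class_in_L2)
qed

text \<open>Cauchy-Schwarz against the constant 1, from \<open>0 \<le> \<integral>(V|f| - m)\<^sup>2\<close> with \<open>V\<close> the total mass and
  \<open>m = \<integral>|f|\<close>.\<close>

lemma norm_integral_sq_le:
  assumes f: "f \<in> sq_integrable M"
  shows "(cmod (LINT x|M. f x))\<^sup>2 \<le> measure M (space M) * (LINT x|M. (cmod (f x))\<^sup>2)"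
proof -
  define V where "V = measure M (space M)"
  define m where "m = (LINT x|M. cmod (f x))"
  define q where "q = (LINT x|M. (cmod (f x))\<^sup>2)"
  have int: "integrable M (\<lambda>x. cmod (f x))" "integrable M (\<lambda>x. (cmod (f x))\<^sup>2)"
    using integrable_sq_integrable[OF f] sq_integrableD(2)[OF f] by auto
  have "0 \<le> (LINT x|M. (V * cmod (f x) - m)\<^sup>2)" by simp
  also have "\<dots> = (LINT x|M. V\<^sup>2 * (cmod (f x))\<^sup>2 - 2 * V * m * cmod (f x) + m\<^sup>2)"
    by (simp add: power2_diff power_mult_distrib algebra_simps)
  also have "\<dots> = V\<^sup>2 * q - 2 * V * m * m + m\<^sup>2 * V"
    using int by (simp add: q_def m_def V_def)
  also have "\<dots> = V * (V * q - m\<^sup>2)" by (simp add: power2_eq_square algebra_simps)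
  finally have "0 \<le> V * (V * q - m\<^sup>2)" .
  moreover have "m = 0" if "V = 0"
  proof -
    have "emeasure M (space M) = 0" using that by (simp add: V_def emeasure_eq_measure)
    then have "AE x in M. False" by (intro AE_I[of _ _ "space M"]) auto
    then have "m = (LINT x|M. (0::real))"
      unfolding m_def using sq_integrableD(1)[OF f] by (intro integral_cong_AE) auto
    then show ?thesis by simp
  qed
  moreover have "0 \<le> V" by (simp add: V_def)
  ultimately have "m\<^sup>2 \<le> V * q"
    by (cases "V = 0") (auto simp: zero_le_mult_iff)
  moreover have "(cmod (LINT x|M. f x))\<^sup>2 \<le> m\<^sup>2"
    unfolding m_def by (intro power_mono integral_norm_bound) auto
  ultimately show ?thesis unfolding V_def q_def by linarith
qed

lemma const_projection_bounded: "const_projection \<in> bounded_ops M"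
  unfolding bounded_ops_def
proof (intro CollectI conjI ballI allI exI)
  show "const_projection \<in> L2 M \<rightarrow>\<^sub>E L2 M"
    unfolding const_projection_def by (auto intro!: l2_class_in_L2 const_sq_integrable)
next
  fix \<xi> \<eta> assume "\<xi> \<in> L2 M" "\<eta> \<in> L2 M"
  then obtain f g where fg: "f \<in> sq_integrable M" "g \<in> sq_integrable M"
    and eq: "\<xi> = l2_class M f" "\<eta> = l2_class M g" by (elim L2E)
  show "const_projection (l2_add M \<xi> \<eta>) = l2_add M (const_projection \<xi>) (const_projection \<eta>)"
    unfolding eq using fg
    by (simp add: l2_add_class const_projection_class sq_integrable_add const_sq_integrable
        integrable_sq_integrable)
next
  fix c \<xi> assume "\<xi> \<in> L2 M"
  then obtain f where f: "f \<in> sq_integrable M" "\<xi> = l2_class M f" by (elim L2E)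
  show "const_projection (l2_scale M c \<xi>) = l2_scale M c (const_projection \<xi>)"
    unfolding f(2) using f(1)
    by (simp add: l2_scale_class const_projection_class sq_integrable_scale const_sq_integrable)
next
  fix \<xi> assume "\<xi> \<in> L2 M"
  then obtain f where f: "f \<in> sq_integrable M" "\<xi> = l2_class M f" by (elim L2E)
  have "measure M (space M) * (cmod (LINT x|M. f x))\<^sup>2
      \<le> (measure M (space M))\<^sup>2 * (LINT x|M. (cmod (f x))\<^sup>2)"
    using mult_left_mono[OF norm_integral_sq_le[OF f(1)] measure_nonneg[of M "space M"]]
    by (simp add: power2_eq_square mult.assoc)
  then have "sqrt (measure M (space M) * (cmod (LINT x|M. f x))\<^sup>2)
      \<le> sqrt ((measure M (space M))\<^sup>2 * (LINT x|M. (cmod (f x))\<^sup>2))"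
    by (rule real_sqrt_le_mono)
  then show "l2_norm M (const_projection \<xi>) \<le> measure M (space M) * l2_norm M \<xi>"
    unfolding f(2) using f(1)
    by (simp add: const_projection_class l2_norm_class const_sq_integrable real_sqrt_mult)
qed

lemma coefficient_const_projection:
  assumes "u \<in> bounded_measurable M" "v \<in> bounded_measurable M"
  shows "coefficient M const_projection u v = (LINT x|M. u x) * (LINT x|M. v x)"
  unfolding coefficient_def
  using assms bounded_sq_integrable[OF bounded_measurable_cnj[OF assms(2)]]
  by (simp add: const_projection_class bounded_sq_integrable l2_inner_class const_sq_integrable
      bounded_measurable_cnj)

end

section \<open>Integral kernels\<close>

text \<open>The operator acts on functions of the second coordinate and yields functions of the first,
  so that the kernel of \<open>M\<^sub>f T M\<^sub>g\<close> carries the factor \<open>f(s) g(t)\<close> as the symbol does.  The kernel is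
  tested in the weak sense, which determines its integral over every rectangle.\<close>
definition has_kernel :: "'a measure \<Rightarrow> 'a l2_op \<Rightarrow> ('a \<times> 'a \<Rightarrow> complex) \<Rightarrow> bool" where
  "has_kernel M T h \<longleftrightarrow> (\<forall>u\<in>bounded_measurable M. \<forall>v\<in>bounded_measurable M.
     coefficient M T u v = (LINT z|(M \<Otimes>\<^sub>M M). h z * (v (fst z) * u (snd z))))"

lemma bounded_measurable_fst:
  "u \<in> bounded_measurable M \<Longrightarrow> (\<lambda>z. u (fst z)) \<in> bounded_measurable (M \<Otimes>\<^sub>M M)"
  unfolding bounded_measurable_def space_pair_measure by auto

lemma bounded_measurable_snd:
  "u \<in> bounded_measurable M \<Longrightarrow> (\<lambda>z. u (snd z)) \<in> bounded_measurable (M \<Otimes>\<^sub>M M)"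
  unfolding bounded_measurable_def space_pair_measure by auto

lemma bounded_measurable_symbol_sum:
  assumes "bounded_square_sums M f" "bounded_square_sums M g"
  shows "symbol_sum f g \<in> bounded_measurable (M \<Otimes>\<^sub>M M)"
  using symbol_sum_measurable[OF assms] symbol_sum_bounded[OF assms]
  unfolding bounded_measurable_def space_pair_measure by blast

lemma bounded_measurable_indicator:
  "A \<in> sets M \<Longrightarrow> indicator A \<in> bounded_measurable M"
  unfolding bounded_measurable_def by (auto intro!: exI[of _ 1] simp: indicator_def)

context finite_measure
begin

lemma bounded_measurable_integrable:
  assumes "u \<in> bounded_measurable M"
  shows "integrable M u"
proof -
  obtain C where "\<forall>x\<in>space M. cmod (u x) \<le> C"
    using assms unfolding bounded_measurable_def by blast
  then show ?thesis
    by (intro integrable_const_bound[of _ C] AE_I2 bounded_measurableD[OF assms]) auto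
qed

lemma pair_finite: "finite_measure (M \<Otimes>\<^sub>M M)"
  by (intro finite_measure_pair_measure finite_measure_axioms)

text \<open>Dominated convergence applies because the partial sums of the symbol are uniformly bounded and
  the measure is finite.\<close>

lemma integral_symbol_sums:
  assumes f: "bounded_square_sums M f" and g: "bounded_square_sums M g"
    and h: "h \<in> bounded_measurable (M \<Otimes>\<^sub>M M)"
  shows "(\<lambda>n. LINT z|(M \<Otimes>\<^sub>M M). h z * (f n (fst z) * g n (snd z)))
     sums (LINT z|(M \<Otimes>\<^sub>M M). h z * symbol_sum f g z)"
proof -
  interpret Q: finite_measure "M \<Otimes>\<^sub>M M" by (rule pair_finite)
  obtain C where C: "\<And>s t N. s \<in> space M \<Longrightarrow> t \<in> space M \<Longrightarrow> cmod (\<Sum>n<N. f n s * g n t) \<le> C"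
    using partial_sums_bounded[OF f g] by blast
  obtain D where D: "\<And>z. z \<in> space (M \<Otimes>\<^sub>M M) \<Longrightarrow> cmod (h z) \<le> D"
    using h unfolding bounded_measurable_def by blast
  have summand: "(\<lambda>z. h z * (f n (fst z) * g n (snd z))) \<in> bounded_measurable (M \<Otimes>\<^sub>M M)" for n
    by (intro bounded_measurable_mult h bounded_measurable_fst bounded_measurable_snd
        bounded_measurable_square_sums f g)
  have "(\<lambda>N. LINT z|(M \<Otimes>\<^sub>M M). (\<Sum>n<N. h z * (f n (fst z) * g n (snd z))))
      \<longlonglongrightarrow> (LINT z|(M \<Otimes>\<^sub>M M). h z * symbol_sum f g z)"
  proof (rule integral_dominated_convergence[where w="\<lambda>_. D * C"])
    show "(\<lambda>z. h z * symbol_sum f g z) \<in> borel_measurable (M \<Otimes>\<^sub>M M)"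
      by (intro bounded_measurableD bounded_measurable_mult h bounded_measurable_symbol_sum f g)
    show "(\<lambda>z. \<Sum>n<N. h z * (f n (fst z) * g n (snd z))) \<in> borel_measurable (M \<Otimes>\<^sub>M M)" for N
      by (intro borel_measurable_sum bounded_measurableD summand)
    show "integrable (M \<Otimes>\<^sub>M M) (\<lambda>_. D * C)" by simp
    show "AE z in M \<Otimes>\<^sub>M M. (\<lambda>N. \<Sum>n<N. h z * (f n (fst z) * g n (snd z))) \<longlonglongrightarrow> h z * symbol_sum f g z"
    proof (rule AE_I2)
      fix z assume "z \<in> space (M \<Otimes>\<^sub>M M)"
      then have "(\<lambda>n. f n (fst z) * g n (snd z)) sums symbol_sum f g (fst z, snd z)"
        by (intro symbol_sum_sums[OF f g]) (auto simp: space_pair_measure)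
      from sums_mult[OF this, of "h z"]
      show "(\<lambda>N. \<Sum>n<N. h z * (f n (fst z) * g n (snd z))) \<longlonglongrightarrow> h z * symbol_sum f g z"
        unfolding sums_def by simp
    qed
    show "AE z in M \<Otimes>\<^sub>M M. norm (\<Sum>n<N. h z * (f n (fst z) * g n (snd z))) \<le> D * C" for N
    proof (rule AE_I2)
      fix z assume z: "z \<in> space (M \<Otimes>\<^sub>M M)"
      then have st: "fst z \<in> space M" "snd z \<in> space M" by (auto simp: space_pair_measure)
      show "norm (\<Sum>n<N. h z * (f n (fst z) * g n (snd z))) \<le> D * C"
        unfolding sum_distrib_left[symmetric] norm_mult
        by (rule mult_mono'[OF D[OF z] C[OF st]]) auto
    qed
  qed
  moreover have "(LINT z|(M \<Otimes>\<^sub>M M). (\<Sum>n<N. h z * (f n (fst z) * g n (snd z))))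
      = (\<Sum>n<N. LINT z|(M \<Otimes>\<^sub>M M). h z * (f n (fst z) * g n (snd z)))" for N
    by (intro Bochner_Integration.integral_sum Q.bounded_measurable_integrable summand)
  ultimately show ?thesis unfolding sums_def by simp
qed

lemma has_kernel_const_projection: "has_kernel M const_projection (\<lambda>_. 1)"
  unfolding has_kernel_def
proof (intro ballI)
  interpret Q: finite_measure "M \<Otimes>\<^sub>M M" by (rule pair_finite)
  interpret P: pair_sigma_finite M M ..
  fix u v assume uv: "u \<in> bounded_measurable M" "v \<in> bounded_measurable M"
  have "(\<lambda>z. v (fst z) * u (snd z)) \<in> bounded_measurable (M \<Otimes>\<^sub>M M)"
    by (intro bounded_measurable_mult bounded_measurable_fst bounded_measurable_snd uv)
  then have "integrable (M \<Otimes>\<^sub>M M) (\<lambda>z. v (fst z) * u (snd z))"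
    by (rule Q.bounded_measurable_integrable)
  from P.integral_fst'[OF this]
  show "coefficient M const_projection u v = (LINT z|(M \<Otimes>\<^sub>M M). 1 * (v (fst z) * u (snd z)))"
    using bounded_measurable_integrable[OF uv(1)] bounded_measurable_integrable[OF uv(2)]
    unfolding coefficient_const_projection[OF uv] by (simp add: mult.commute)
qed

text \<open>Each summand \<open>M\<^sub>f T M\<^sub>g\<close> multiplies the kernel by \<open>f(s) g(t)\<close>; the series of these
  products is the symbol.\<close>

lemma has_kernel_represented:
  assumes rep: "represents M \<Phi> f g" and T: "T \<in> bounded_ops M"
    and h: "h \<in> bounded_measurable (M \<Otimes>\<^sub>M M)" and kernel: "has_kernel M T h"
  shows "has_kernel M (\<Phi> T) (\<lambda>z. h z * symbol_sum f g z)"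
  unfolding has_kernel_def
proof (intro ballI)
  fix u v assume uv: "u \<in> bounded_measurable M" "v \<in> bounded_measurable M"
  have f: "bounded_square_sums M f" and g: "bounded_square_sums M g"
    using rep unfolding represents_def by auto
  have "coefficient M T (\<lambda>x. g n x * u x) (\<lambda>x. f n x * v x)
      = (LINT z|(M \<Otimes>\<^sub>M M). h z * (v (fst z) * u (snd z)) * (f n (fst z) * g n (snd z)))" for n
    using kernel bounded_measurable_mult[OF bounded_measurable_square_sums[OF g] uv(1)]
      bounded_measurable_mult[OF bounded_measurable_square_sums[OF f] uv(2)]
    unfolding has_kernel_def by (simp add: ac_simps)
  moreover have "(\<lambda>n. LINT z|(M \<Otimes>\<^sub>M M). h z * (v (fst z) * u (snd z)) * (f n (fst z) * g n (snd z)))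
      sums (LINT z|(M \<Otimes>\<^sub>M M). h z * (v (fst z) * u (snd z)) * symbol_sum f g z)"
    by (intro integral_symbol_sums f g bounded_measurable_mult bounded_measurable_fst
        bounded_measurable_snd h uv)
  ultimately have "coefficient M (\<Phi> T) u v
      = (LINT z|(M \<Otimes>\<^sub>M M). h z * (v (fst z) * u (snd z)) * symbol_sum f g z)"
    using coefficient_sums[OF rep T uv] sums_unique2 by force
  then show "coefficient M (\<Phi> T) u v
      = (LINT z|(M \<Otimes>\<^sub>M M). h z * symbol_sum f g z * (v (fst z) * u (snd z)))"
    by (simp add: ac_simps)
qed

lemma null_side_if_positive:
  assumes ab: "\<alpha> \<in> sets M" "\<beta> \<in> sets M"
    and h: "h \<in> bounded_measurable (M \<Otimes>\<^sub>M M)"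
    and pos: "\<And>z. z \<in> \<alpha> \<times> \<beta> \<Longrightarrow> 0 < Re (h z)"
    and zero: "(LINT z|(M \<Otimes>\<^sub>M M). h z * (indicator \<alpha> (fst z) * indicator \<beta> (snd z))) = 0"
  shows "\<alpha> \<in> null_sets M \<or> \<beta> \<in> null_sets M"
proof -
  interpret Q: finite_measure "M \<Otimes>\<^sub>M M" by (rule pair_finite)
  define k where "k z = h z * (indicator \<alpha> (fst z) * indicator \<beta> (snd z))" for z
  have "k \<in> bounded_measurable (M \<Otimes>\<^sub>M M)"
    unfolding k_def
    by (intro bounded_measurable_mult h bounded_measurable_fst bounded_measurable_snd
        bounded_measurable_indicator ab)
  then have int: "integrable (M \<Otimes>\<^sub>M M) k" by (rule Q.bounded_measurable_integrable)
  have Re_k: "Re (k z) = (if z \<in> \<alpha> \<times> \<beta> then Re (h z) else 0)" for z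
    by (cases z) (auto simp: k_def indicator_def)
  have "(LINT z|(M \<Otimes>\<^sub>M M). Re (k z)) = 0"
    using zero integral_Re[OF int] unfolding k_def by simp
  moreover have "AE z in M \<Otimes>\<^sub>M M. 0 \<le> Re (k z)"
    using pos by (intro AE_I2) (auto simp: Re_k less_imp_le)
  ultimately have "AE z in M \<Otimes>\<^sub>M M. Re (k z) = 0"
    using integral_nonneg_eq_0_iff_AE[OF integrable_Re[OF int]] by simp
  then have "AE z in M \<Otimes>\<^sub>M M. z \<notin> \<alpha> \<times> \<beta>"
    by eventually_elim (use pos in \<open>force simp: Re_k split: if_splits\<close>)
  then have "emeasure (M \<Otimes>\<^sub>M M) (\<alpha> \<times> \<beta>) = 0"
    using ab by (subst (asm) AE_iff_measurable[of "\<alpha> \<times> \<beta>"])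
      (auto simp: space_pair_measure dest: sets.sets_into_space)
  then show ?thesis
    using ab by (simp add: emeasure_pair_measure_Times null_sets_def)
qed

section \<open>Idempotents\<close>

text \<open>Applying \<open>P\<close> once and twice to the operator with kernel 1 gives kernels \<open>\<psi>\<close> and \<open>\<psi>\<^sup>2\<close>, and both
  operators are the same.  The set \<open>{\<psi>\<^sup>2 \<noteq> \<psi>}\<close> is cut into four pieces according to open half
  planes, since vanishing integrals give information only when the integrand has one sign.\<close>

lemma idempotent_symbol_marginally:
  assumes rep: "represents M P f g"
    and P: "\<And>T. T \<in> bounded_ops M \<Longrightarrow> P T \<in> bounded_ops M"
    and idem: "\<And>T. T \<in> bounded_ops M \<Longrightarrow> P (P T) = P T"
  shows "marginally_null M
    {z \<in> space M \<times> space M. symbol_sum f g z \<noteq> 0 \<and> symbol_sum f g z \<noteq> 1}"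
proof -
  interpret Q: finite_measure "M \<Otimes>\<^sub>M M" by (rule pair_finite)
  have f: "bounded_square_sums M f" and g: "bounded_square_sums M g"
    using rep unfolding represents_def by auto
  define \<psi> where "\<psi> = symbol_sum f g"
  define E :: "complex \<Rightarrow> ('a \<times> 'a) set" where
    "E c = {z \<in> space M \<times> space M. \<psi> z \<in> {w. 0 < Re (c * (w * w - w))}}" for c
  have \<psi>: "\<psi> \<in> bounded_measurable (M \<Otimes>\<^sub>M M)"
    unfolding \<psi>_def by (rule bounded_measurable_symbol_sum[OF f g])
  have one: "(\<lambda>_. 1) \<in> bounded_measurable (M \<Otimes>\<^sub>M M)"
    by (rule bounded_measurable_const)
  note T0 = const_projection_bounded
  have K1: "has_kernel M (P const_projection) \<psi>"
    using has_kernel_represented[OF rep T0 one has_kernel_const_projection] by (simp add: \<psi>_def)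
  have K2: "has_kernel M (P const_projection) (\<lambda>z. \<psi> z * \<psi> z)"
    using has_kernel_represented[OF rep P[OF T0] \<psi> K1] idem[OF T0] by (simp add: \<psi>_def)
  have "marginally_null M (E c)" for c
  proof (rule marginally_null_rect_open)
    have "open {w. 0 < Re (c * (w * w - w))}"
      by (intro open_Collect_less continuous_intros)
    then show "rect_open M (E c)"
      unfolding E_def \<psi>_def by (rule rect_continuousD[OF rect_continuous_symbol_sum[OF f g]])
  next
    fix \<alpha> \<beta> assume ab: "\<alpha> \<in> sets M" "\<beta> \<in> sets M" "\<alpha> \<times> \<beta> \<subseteq> E c"
    define r where "r z = indicator \<alpha> (fst z) * (indicator \<beta> (snd z) :: complex)" for z :: "'a \<times> 'a"
    have r: "r \<in> bounded_measurable (M \<Otimes>\<^sub>M M)"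
      unfolding r_def
      by (intro bounded_measurable_mult bounded_measurable_fst bounded_measurable_snd
          bounded_measurable_indicator ab)
    have int: "integrable (M \<Otimes>\<^sub>M M) (\<lambda>z. \<psi> z * r z)" "integrable (M \<Otimes>\<^sub>M M) (\<lambda>z. \<psi> z * \<psi> z * r z)"
      by (intro Q.bounded_measurable_integrable bounded_measurable_mult \<psi> r)+
    have K: "coefficient M (P const_projection) (indicator \<beta>) (indicator \<alpha>) = (LINT z|(M \<Otimes>\<^sub>M M). h z * r z)"
      if "has_kernel M (P const_projection) h" for h
      using that bounded_measurable_indicator[OF ab(1)] bounded_measurable_indicator[OF ab(2)]
      unfolding has_kernel_def r_def by blast
    have eq: "(LINT z|(M \<Otimes>\<^sub>M M). \<psi> z * \<psi> z * r z) = (LINT z|(M \<Otimes>\<^sub>M M). \<psi> z * r z)"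
      using K[OF K1] K[OF K2] by simp
    have "(LINT z|(M \<Otimes>\<^sub>M M). c * (\<psi> z * \<psi> z - \<psi> z) * r z)
        = (LINT z|(M \<Otimes>\<^sub>M M). c * (\<psi> z * \<psi> z * r z - \<psi> z * r z))"
      by (simp add: algebra_simps)
    also have "\<dots> = 0"
      using int eq by simp
    finally have zero: "(LINT z|(M \<Otimes>\<^sub>M M). c * (\<psi> z * \<psi> z - \<psi> z) * r z) = 0" .
    have "(\<lambda>z. c * (\<psi> z * \<psi> z + (-1) * \<psi> z)) \<in> bounded_measurable (M \<Otimes>\<^sub>M M)"
      by (intro bounded_measurable_mult bounded_measurable_add bounded_measurable_const \<psi>)
    then have "(\<lambda>z. c * (\<psi> z * \<psi> z - \<psi> z)) \<in> bounded_measurable (M \<Otimes>\<^sub>M M)"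
      by simp
    then show "\<alpha> \<in> null_sets M \<or> \<beta> \<in> null_sets M"
      by (rule null_side_if_positive[OF ab(1,2)])
        (use ab(3) zero in \<open>auto simp: E_def r_def\<close>)
  qed
  \<comment> \<open>The four half planes around the coordinate axes cover all nonzero complex numbers.\<close>
  then have "marginally_null M (E 1 \<union> E (-1) \<union> E \<i> \<union> E (-\<i>))"
    by (intro marginally_null_Un)
  then show ?thesis
  proof (rule marginally_null_subset, intro subsetI)
    fix z assume z: "z \<in> {z \<in> space M \<times> space M. symbol_sum f g z \<noteq> 0 \<and> symbol_sum f g z \<noteq> 1}"
    define w where "w = \<psi> z * \<psi> z - \<psi> z"
    have "w = \<psi> z * (\<psi> z - 1)" by (simp add: w_def algebra_simps)
    then have "w \<noteq> 0" using z by (simp add: \<psi>_def)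
    then have "0 < Re (1 * w) \<or> 0 < Re (-1 * w) \<or> 0 < Re (\<i> * w) \<or> 0 < Re (-\<i> * w)"
      by (auto simp: complex_eq_iff)
    then show "z \<in> E 1 \<union> E (-1) \<union> E \<i> \<union> E (-\<i>)"
      using z unfolding E_def w_def by blast
  qed
qed

end

theorem proposition11:
  fixes M :: "'a measure"
    and P :: "'a l2_op \<Rightarrow> 'a l2_op"
    and \<phi> :: "'a \<times> 'a \<Rightarrow> complex"
  assumes "standard_finite_measure M"
    and "P \<in> NCB M"
    and "idempotent_map M P"
    and "\<phi> \<in> symbol M P"
  shows "\<exists>A. omega_open M A \<and> omega_closed M A \<and> mae_eq M \<phi> (indicator A)"
proof -
  interpret finite_measure M using assms(1) by (simp add: standard_finite_measure_def)
  obtain f g where rep: "represents M P f g" and \<phi>: "mae_eq M \<phi> (symbol_sum f g)"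
    using assms(4) unfolding symbol_def symbol_sum_def by blast
  have f: "bounded_square_sums M f" and g: "bounded_square_sums M g"
    using rep unfolding represents_def by auto
  have P: "P T \<in> bounded_ops M" if "T \<in> bounded_ops M" for T
    using assms(2) that unfolding NCB_def by auto
  have idem: "P (P T) = P T" if "T \<in> bounded_ops M" for T
    using assms(3) that unfolding idempotent_map_def by (metis compose_eq)
  define \<psi> where "\<psi> = symbol_sum f g"
  define R where "R = {z \<in> space M \<times> space M. \<psi> z \<noteq> 0 \<and> \<psi> z \<noteq> 1}"
  have R: "marginally_null M R"
    unfolding R_def \<psi>_def by (rule idempotent_symbol_marginally[OF rep P idem])
  define A where "A = {z \<in> space M \<times> space M. \<psi> z \<in> - {0}}"
  define B where "B = {z \<in> space M \<times> space M. \<psi> z \<in> - {1}}"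
  have opens: "rect_open M {z \<in> space M \<times> space M. \<psi> z \<in> U}" if "open U" for U
    unfolding \<psi>_def by (rule rect_continuousD[OF rect_continuous_symbol_sum[OF f g] that])
  have A: "rect_open M A" unfolding A_def by (rule opens) (rule open_Compl[OF closed_singleton])
  have B: "rect_open M B" unfolding B_def by (rule opens) (rule open_Compl[OF closed_singleton])
  have "omega_open M A"
    by (rule omega_open_if_near_rect_open[OF _ A])
      (auto simp: A_def intro: marginally_null_subset[OF R])
  moreover have "omega_closed M A"
    unfolding omega_closed_def
  proof (intro conjI)
    show "A \<subseteq> space M \<times> space M" by (auto simp: A_def)
    show "omega_open M (space M \<times> space M - A)"
      by (rule omega_open_if_near_rect_open[OF _ B])
        (auto simp: A_def B_def R_def intro: marginally_null_subset[OF R])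
  qed
  moreover have "mae_eq M \<phi> (indicator A)"
    using marginally_null_Un[OF \<phi>[unfolded mae_eq_def] R] unfolding mae_eq_def
    by (rule marginally_null_subset) (auto simp: A_def R_def \<psi>_def indicator_def)
  ultimately show ?thesis by blast
qed

end
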